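(* Let $\ell, r \geq 1$ be integers and let $\mathcal{H}$ be a finite $\ell$-bounded set system with $\mathrm{VC}(\mathcal{H}) \leq 1$. If $|\mathcal{H}| > (r-1)^{\ell}$, then $\mathcal{H}$ contains an $r$-sunflower.
   Context: A set system (set family) $\mathcal{H}$ is $\ell$-bounded if every set in $\mathcal{H}$ has size at most $\ell$. A family of $r$ distinct sets $\{A_1,\ldots,A_r\}$ is an $r$-sunflower if for all $1 \leq i < j \leq r$ and $1 \leq i' < j' \leq r$ we have $A_i \cap A_j = A_{i'} \cap A_{j'}$. "$\mathcal{H}$ contains an $r$-sunflower" means that some $r$ distinct members of $\mathcal{H}$ form an $r$-sunflower. The VC-dimension $\mathrm{VC}(\mathcal{H})$ of a set family $\mathcal{H}$ on a ground set $X$ is the maximum $d$ for which there exists a subset $T \subseteq X$ of size $d$ such that for all $A \subseteq T$ there is some $S \in \mathcal{H}$ with $T \cap S = A$. *)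

theory Defs
  imports Main "HOL-Library.Extended_Nat"
begin

definition bounded_family :: "nat \<Rightarrow> 'a set set \<Rightarrow> bool" where
  "bounded_family l H \<longleftrightarrow> (\<forall>S\<in>H. finite S \<and> card S \<le> l)"

text \<open>A family of \<open>r\<close> distinct sets is represented by the set of its members; since the
  intersection is commutative, pairs of indices \<open>i < j\<close> become pairs of distinct members.\<close>

definition sunflower :: "nat \<Rightarrow> 'a set set \<Rightarrow> bool" where
  "sunflower r F \<longleftrightarrow> finite F \<and> card F = r \<and>
     (\<forall>A\<in>F. \<forall>B\<in>F. \<forall>C\<in>F. \<forall>D\<in>F. A \<noteq> B \<longrightarrow> C \<noteq> D \<longrightarrow> A \<inter> B = C \<inter> D)"

definition contains_sunflower :: "nat \<Rightarrow> 'a set set \<Rightarrow> bool" where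
  "contains_sunflower r H \<longleftrightarrow> (\<exists>F\<subseteq>H. sunflower r F)"

definition shatters :: "'a set set \<Rightarrow> 'a set \<Rightarrow> bool" where
  "shatters H T \<longleftrightarrow> (\<forall>A\<subseteq>T. \<exists>S\<in>H. T \<inter> S = A)"

text \<open>The maximum is taken as a supremum in \<^typ>\<open>enat\<close>, so that it is \<open>\<infinity>\<close> when
  there are shattered sets of every finite size. The empty family shatters nothing, not even the
  empty set; its dimension is \<open>0\<close> here.\<close>

definition vc_dim :: "'a set \<Rightarrow> 'a set set \<Rightarrow> enat" where
  "vc_dim X H = (SUP T\<in>{T. T \<subseteq> X \<and> finite T \<and> shatters H T}. enat (card T))"

end

theory Submission
  imports Defs "HOL-Library.Disjoint_Sets"
begin

text \<open>Induction on \<open>l\<close>, for a family in which no two-element set is shattered; the links of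
  points satisfy the same hypotheses with \<open>l - 1\<close>. If two points meet every member, the family is
  covered by two links, and \<open>2 (r - 1)\<^sup>l\<^sup>-\<^sup>1 \<le> (r - 1)\<^sup>l\<close> once \<open>r \<ge> 3\<close>. Otherwise every pair of points
  is missed by some member, so not shattering the pair forces the stars of any two points to
  be disjoint or nested. Then in a maximal disjoint subfamily each nonempty member \<open>S\<close> has a
  point, the one with the largest star, that lies in every member meeting \<open>S\<close>. The disjoint
  subfamily is a sunflower, so at most \<open>r - 1\<close> links cover the family.\<close>

section \<open>Stars and links of points\<close>

definition star :: "'a \<Rightarrow> 'a set set \<Rightarrow> 'a set set" where
  "star x H = {A \<in> H. x \<in> A}"

text \<open>Requiring \<open>x \<notin> A\<close> makes \<open>insert x\<close> injective here, so
  the link is as large as the star while its finite members are one smaller.\<close>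

definition link :: "'a \<Rightarrow> 'a set set \<Rightarrow> 'a set set" where
  "link x H = {A. x \<notin> A \<and> insert x A \<in> H}"

lemma star_eq_image_link: "star x H = insert x ` link x H"
proof
  show "star x H \<subseteq> insert x ` link x H"
  proof
    fix A assume "A \<in> star x H"
    then have "A = insert x (A - {x})" "A - {x} \<in> link x H"
      by (auto simp: star_def link_def insert_absorb)
    then show "A \<in> insert x ` link x H" by blast
  qed
qed (auto simp: star_def link_def)

lemma inj_on_insert_link: "inj_on (insert x) (link x H)"
  by (auto simp: inj_on_def link_def)

lemma card_link: "card (link x H) = card (star x H)"
  by (simp add: star_eq_image_link card_image inj_on_insert_link)

lemma finite_star: "finite H \<Longrightarrow> finite (star x H)"
  by (simp add: star_def)

lemma finite_link: "finite H \<Longrightarrow> finite (link x H)"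
  using finite_star[of H x] unfolding star_eq_image_link
  by (rule finite_imageD[OF _ inj_on_insert_link])

lemma bounded_family_link:
  assumes "bounded_family (Suc l) H"
  shows "bounded_family l (link x H)"
  unfolding bounded_family_def
proof
  fix A assume "A \<in> link x H"
  then have A: "x \<notin> A" "insert x A \<in> H" by (auto simp: link_def)
  then have "finite (insert x A)" "card (insert x A) \<le> Suc l"
    using assms by (auto simp: bounded_family_def)
  then show "finite A \<and> card A \<le> l" using A by simp
qed

text \<open>Realising the trace \<open>T\<close> itself puts \<open>T\<close> inside a link member,
  so \<open>x \<notin> T\<close>, and adding \<open>x\<close> to members changes no trace on
  \<open>T\<close>.\<close>

lemma shatters_link:
  assumes "shatters (link x H) T"
  shows "shatters H T"
proof -
  have "x \<notin> T"
    using assms unfolding shatters_def link_def by blast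
  then have Int_eq: "T \<inter> insert x S = T \<inter> S" for S by blast
  show ?thesis
    unfolding shatters_def
  proof (intro allI impI)
    fix A assume "A \<subseteq> T"
    then obtain S where "S \<in> link x H" "T \<inter> S = A"
      using assms unfolding shatters_def by blast
    then have "insert x S \<in> H" "T \<inter> insert x S = A"
      by (auto simp only: link_def Int_eq mem_Collect_eq)
    then show "\<exists>S\<in>H. T \<inter> S = A" by (rule bexI[rotated])
  qed
qed

section \<open>Sources of sunflowers\<close>

lemma sunflowerI:
  assumes "finite F" "card F = r"
    and "\<And>A B C D. \<lbrakk>A \<in> F; B \<in> F; C \<in> F; D \<in> F; A \<noteq> B; C \<noteq> D\<rbrakk> \<Longrightarrow> A \<inter> B = C \<inter> D"
  shows "sunflower r F"
  unfolding sunflower_def by (intro conjI ballI impI assms)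

lemma sunflower_Int_eq:
  assumes "sunflower r F" "A \<in> F" "B \<in> F" "C \<in> F" "D \<in> F" "A \<noteq> B" "C \<noteq> D"
  shows "A \<inter> B = C \<inter> D"
  using assms unfolding sunflower_def by meson

lemma sunflower_insert_image:
  assumes F: "sunflower r F" and x: "\<And>A. A \<in> F \<Longrightarrow> x \<notin> A"
  shows "sunflower r (insert x ` F)"
proof (rule sunflowerI)
  have "inj_on (insert x) F"
    using x by (intro inj_onI) (simp add: insert_ident)
  then show "finite (insert x ` F)" "card (insert x ` F) = r"
    using F by (auto simp: sunflower_def card_image)
next
  fix A B C D
  assume "A \<in> insert x ` F" "B \<in> insert x ` F" "C \<in> insert x ` F" "D \<in> insert x ` F"
    and neq: "A \<noteq> B" "C \<noteq> D"
  then obtain A' B' C' D' where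
    *: "A = insert x A'" "B = insert x B'" "C = insert x C'" "D = insert x D'"
      "A' \<in> F" "B' \<in> F" "C' \<in> F" "D' \<in> F"
    by (elim imageE)
  then have "A' \<inter> B' = C' \<inter> D'"
    using neq by (intro sunflower_Int_eq[OF F]) auto
  then show "A \<inter> B = C \<inter> D"
    using *(1-4) by (simp only: insert_inter_insert)
qed

lemma contains_sunflower_link:
  assumes "contains_sunflower r (link x H)"
  shows "contains_sunflower r H"
proof -
  obtain F where F: "F \<subseteq> link x H" "sunflower r F"
    using assms by (auto simp: contains_sunflower_def)
  then have "sunflower r (insert x ` F)"
    by (intro sunflower_insert_image) (auto simp: link_def)
  moreover have "insert x ` F \<subseteq> H"
    using F by (auto simp: link_def)
  ultimately show ?thesis by (auto simp: contains_sunflower_def)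
qed

lemma contains_sunflower_disjoint:
  assumes "F \<subseteq> H" "disjoint F" "r \<le> card F"
  shows "contains_sunflower r H"
proof -
  obtain G where G: "G \<subseteq> F" "card G = r" "finite G"
    using obtain_subset_with_card_n[OF assms(3)] by metis
  have "A \<inter> B = {}" if "A \<in> G" "B \<in> G" "A \<noteq> B" for A B
    using that G(1) assms(2) by (auto dest: disjointD)
  then have "sunflower r G"
    using G by (intro sunflowerI) simp_all
  then show ?thesis
    using G assms(1) unfolding contains_sunflower_def by blast
qed

text \<open>At most two sets form at most one unordered pair, so there is only one intersection to
  compare.\<close>

lemma contains_sunflower_at_most_two:
  assumes "r \<le> 2" "r \<le> card H"
  shows "contains_sunflower r H"
proof -
  obtain G where G: "G \<subseteq> H" "card G = r" "finite G"
    using obtain_subset_with_card_n[OF assms(2)] by metis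
  have pair: "{A, B} = G" if "A \<in> G" "B \<in> G" "A \<noteq> B" for A B
    using that G assms(1) by (intro card_seteq) auto
  have "sunflower r G"
  proof (rule sunflowerI)
    fix A B C D
    assume "A \<in> G" "B \<in> G" "C \<in> G" "D \<in> G" "A \<noteq> B" "C \<noteq> D"
    then have "{A, B} = {C, D}" using pair by simp
    then show "A \<inter> B = C \<inter> D" by (auto simp: doubleton_eq_iff)
  qed (use G in simp_all)
  then show ?thesis
    using G unfolding contains_sunflower_def by blast
qed

section \<open>Shattered pairs, disjoint subfamilies and the cardinality bound\<close>

lemma shatters_pairI:
  assumes "A \<in> H" "x \<in> A" "y \<in> A" "B \<in> H" "x \<in> B" "y \<notin> B"
    and "C \<in> H" "x \<notin> C" "y \<in> C" "D \<in> H" "x \<notin> D" "y \<notin> D"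
  shows "shatters H {x, y}"
  unfolding shatters_def
proof (intro allI impI)
  fix E assume "E \<subseteq> {x, y}"
  then have "E = {x, y} \<or> E = {x} \<or> E = {y} \<or> E = {}" by blast
  moreover have "{x, y} \<inter> A = {x, y}" "{x, y} \<inter> B = {x}" "{x, y} \<inter> C = {y}" "{x, y} \<inter> D = {}"
    using assms by auto
  ultimately show "\<exists>S\<in>H. {x, y} \<inter> S = E"
    using assms by metis
qed

text \<open>The alternative \<open>A \<in> F\<close> matters only for \<open>A = {}\<close>, which
  meets nothing; any nonempty member of \<open>F\<close> meets itself.\<close>

lemma exists_maximal_disjoint_subfamily:
  assumes "finite H"
  obtains F where "F \<subseteq> H" "disjoint F"
    "\<And>A. A \<in> H \<Longrightarrow> A \<in> F \<or> (\<exists>S\<in>F. A \<inter> S \<noteq> {})"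
proof -
  let ?P = "{F. F \<subseteq> H \<and> disjoint F}"
  have "finite ?P" using assms by simp
  moreover have "{} \<in> ?P" by (simp add: disjoint_def)
  ultimately obtain F where F: "F \<in> ?P" and max: "\<And>G. G \<in> ?P \<Longrightarrow> F \<subseteq> G \<Longrightarrow> F = G"
    using finite_has_maximal[of ?P] by (metis (no_types, lifting) empty_iff)
  have "A \<in> F \<or> (\<exists>S\<in>F. A \<inter> S \<noteq> {})" if "A \<in> H" for A
  proof (rule ccontr)
    assume *: "\<not> ?thesis"
    then have "insert A F \<in> ?P"
      using F that by (auto simp: disjoint_def)
    then have "A \<in> F" using max by blast
    then show False using * by blast
  qed
  then show thesis using that F by blast
qed

text \<open>Take \<open>s\<close> in \<open>S\<close> with the largest star. If \<open>A\<close>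
  contains \<open>y \<in> S\<close> but not \<open>s\<close>, the star of \<open>s\<close> lies in
  that of \<open>y\<close>; maximality makes them equal, yet \<open>A\<close> separates
  them.\<close>

lemma dominating_point:
  assumes fin: "finite H" and S: "S \<in> H" "finite S" "S \<noteq> {}"
    and unshattered: "\<And>x y. x \<noteq> y \<Longrightarrow> \<not> shatters H {x, y}"
    and missed: "\<And>x y. x \<noteq> y \<Longrightarrow> \<exists>A\<in>H. x \<notin> A \<and> y \<notin> A"
  obtains s where "\<And>A. A \<in> H \<Longrightarrow> A \<inter> S \<noteq> {} \<Longrightarrow> s \<in> A"
proof -
  have "Max ((\<lambda>x. card (star x H)) ` S) \<in> (\<lambda>x. card (star x H)) ` S"
    using S by (intro Max_in) auto
  then obtain s where s: "s \<in> S" "card (star s H) = Max ((\<lambda>x. card (star x H)) ` S)"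
    by auto
  have "s \<in> A" if A: "A \<in> H" "A \<inter> S \<noteq> {}" for A
  proof (rule ccontr)
    assume "s \<notin> A"
    obtain y where y: "y \<in> A" "y \<in> S" using A by blast
    have "s \<noteq> y" using y \<open>s \<notin> A\<close> by blast
    obtain D where D: "D \<in> H" "s \<notin> D" "y \<notin> D" using missed[OF \<open>s \<noteq> y\<close>] by blast
    \<comment> \<open>Otherwise \<open>S\<close>, \<open>B\<close>, \<open>A\<close> and
      \<open>D\<close> realise all four traces on \<open>{s, y}\<close>.\<close>
    have "y \<in> B" if "B \<in> H" "s \<in> B" for B
      using shatters_pairI[OF S(1) s(1) y(2) that _ A(1) \<open>s \<notin> A\<close> y(1) D] unshattered[OF \<open>s \<noteq> y\<close>]
      by blast
    then have "star s H \<subseteq> star y H"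
      by (auto simp: star_def)
    moreover have "card (star y H) \<le> card (star s H)"
      using s y S by simp
    ultimately have "star s H = star y H"
      using fin by (intro card_seteq finite_star)
    then show False
      using A y \<open>s \<notin> A\<close> by (auto simp: star_def)
  qed
  then show thesis using that by blast
qed

text \<open>Forbidding shattered pairs, rather than bounding the VC-dimension, avoids a ground set
  and passes directly to links.\<close>

lemma card_le_if_no_sunflower:
  assumes "finite H" "bounded_family l H"
    and "\<And>x y. x \<noteq> y \<Longrightarrow> \<not> shatters H {x, y}"
    and "r \<ge> 1" "\<not> contains_sunflower r H"
  shows "card H \<le> (r - 1) ^ l"
  using assms
proof (induction l arbitrary: H)
  case 0
  \<comment> \<open>The bound is 1 even for \<open>r = 1\<close>, since
    \<open>0 ^ 0 = 1\<close>.\<close>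
  then have "H \<subseteq> {{}}" by (auto simp: bounded_family_def)
  then have "card H \<le> card {{} :: 'a set}" by (intro card_mono) auto
  then show ?case by simp
next
  case (Suc l)
  have star_le: "card (star x H) \<le> (r - 1) ^ l" for x
    using Suc.IH[of "link x H"] Suc.prems finite_link[of H x] bounded_family_link[of l H x]
      shatters_link[of x H] contains_sunflower_link[of r x H] card_link[of x H]
    by metis
  show ?case
  proof (cases "r \<le> 2")
    case True
    then have "card H < r"
      using contains_sunflower_at_most_two[of r H] Suc.prems by linarith
    \<comment> \<open>Both 0 and 1 are unchanged by the positive exponent
      \<open>Suc l\<close>.\<close>
    moreover have "r - 1 = 0 \<or> r - 1 = 1" using True by linarith
    ultimately show ?thesis by auto
  next
    case False
    show ?thesis
    proof (cases "\<exists>x y. x \<noteq> y \<and> (\<forall>A\<in>H. x \<in> A \<or> y \<in> A)")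
      case True
      then obtain x y where "\<forall>A\<in>H. x \<in> A \<or> y \<in> A" by blast
      then have "H = star x H \<union> star y H" by (auto simp: star_def)
      then have "card H \<le> card (star x H) + card (star y H)"
        by (metis card_Un_le)
      also have "\<dots> \<le> 2 * (r - 1) ^ l"
        using star_le[of x] star_le[of y] by linarith
      also have "\<dots> \<le> (r - 1) * (r - 1) ^ l"
        using False by (intro mult_right_mono) auto
      finally show ?thesis by simp
    next
      case no_cover: False
      obtain F where F: "F \<subseteq> H" "disjoint F"
        and meets: "\<And>A. A \<in> H \<Longrightarrow> A \<in> F \<or> (\<exists>S\<in>F. A \<inter> S \<noteq> {})"
        using exists_maximal_disjoint_subfamily[OF Suc.prems(1)] by blast
      have "finite F" using F Suc.prems(1) finite_subset by blast
      have "card F \<le> r - 1"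
        using contains_sunflower_disjoint[OF F, of r] Suc.prems(5) by linarith
      \<comment> \<open>\<open>S\<close> is inserted explicitly so that an empty \<open>S\<close> is
        covered too.\<close>
      define N where "N S = insert S {A \<in> H. A \<inter> S \<noteq> {}}" for S
      have N_le: "card (N S) \<le> (r - 1) ^ l" if "S \<in> F" for S
      proof (cases "S = {}")
        case True
        \<comment> \<open>\<open>N {}\<close> is the singleton \<open>{{}}\<close>, and
          \<open>r \<ge> 3\<close> makes the bound at least 1.\<close>
        then show ?thesis using False by (simp add: N_def)
      next
        case False
        have S: "S \<in> H" "finite S"
          using that F Suc.prems(2) by (auto simp: bounded_family_def)
        obtain s where s: "\<And>A. A \<in> H \<Longrightarrow> A \<inter> S \<noteq> {} \<Longrightarrow> s \<in> A"
          using dominating_point[OF Suc.prems(1) S False Suc.prems(3)] no_cover by metis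
        then have "N S \<subseteq> star s H"
          using S False by (auto simp: N_def star_def)
        then have "card (N S) \<le> card (star s H)"
          by (intro card_mono finite_star Suc.prems(1))
        then show ?thesis using star_le[of s] by linarith
      qed
      have "finite (\<Union>S\<in>F. N S)"
        using \<open>finite F\<close> Suc.prems(1) by (auto simp: N_def)
      moreover have "H \<subseteq> (\<Union>S\<in>F. N S)"
        using meets by (auto simp: N_def)
      ultimately have "card H \<le> card (\<Union>S\<in>F. N S)"
        by (intro card_mono)
      also have "\<dots> \<le> (\<Sum>S\<in>F. card (N S))"
        using \<open>finite F\<close> by (rule card_UN_le)
      also have "\<dots> \<le> card F * (r - 1) ^ l"
        using sum_bounded_above[of F "\<lambda>S. card (N S)"] N_le by simp
      also have "\<dots> \<le> (r - 1) * (r - 1) ^ l"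
        using \<open>card F \<le> r - 1\<close> by (intro mult_right_mono) auto
      finally show ?thesis by simp
    qed
  qed
qed

text \<open>A member realising the full trace places the pair inside \<open>X\<close>, so its
  cardinality 2 enters the supremum.\<close>

lemma not_shatters_pair_if_vc_dim_le_1:
  assumes "H \<subseteq> Pow X" "vc_dim X H \<le> 1" "x \<noteq> y"
  shows "\<not> shatters H {x, y}"
proof
  assume sh: "shatters H {x, y}"
  then obtain S where "S \<in> H" "{x, y} \<inter> S = {x, y}"
    unfolding shatters_def by blast
  then have "{x, y} \<subseteq> X" using assms(1) by blast
  then have "enat (card {x, y}) \<le> vc_dim X H"
    unfolding vc_dim_def using sh by (intro SUP_upper) auto
  then have "enat (card {x, y}) \<le> 1"
    using assms(2) by (rule order_trans)
  then show False
    using assms(3) by (simp add: one_enat_def)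
qed

theorem theorem1p4:
  fixes l r :: nat and X :: "'a set" and H :: "'a set set"
  assumes "l \<ge> 1" and "r \<ge> 1"
    and "H \<subseteq> Pow X"
    and "finite H"
    and "bounded_family l H"
    and "vc_dim X H \<le> 1"
    and "card H > (r - 1) ^ l"
  shows "contains_sunflower r H"
  using card_le_if_no_sunflower[OF assms(4,5) _ assms(2)]
    not_shatters_pair_if_vc_dim_le_1[OF assms(3,6)] assms(7)
  by (meson not_le)

end
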